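(* Let $V$ be a finite set of size $n$, let $f\colon 2^V\to\mathbb{R}_{\geq 0}$ be a monotone subadditive function with $f(\emptyset)=0$ and curvature $\alpha\in[0,1]$, let $B_1,\dots,B_k$ be pairwise disjoint subsets of $V$, and let $d_1,\dots,d_k$ be integers with $1\le d_i\le |B_i|$ for all $i\in[k]$. Put $d=\sum_{i=1}^k d_i$ and $\overline{d}=\min_i d_i$. Then \textsc{Greedy} is a $\frac{1}{\alpha}\left(1-e^{(\alpha^2-\alpha)\overline{d}/d}\right)$-approximation algorithm for the problem $\max_{S\subseteq V}\{f(S): |S\cap B_i|\le d_i \ \forall i\in[k]\}$, and its run-time is $O(dn)$ oracle evaluations of $f$.
   Context: $f$ is subadditive if $f(U)+f(W)\ge f(U\cup W)$ for all $U,W\subseteq V$, and monotone if $f(S)\le f(T)$ whenever $S\subseteq T$. The function $f$ is accessed through a value oracle returning $f(U)$; run time is the number of oracle calls. For $S,\Omega\subseteq V$ write $\rho_\Omega(S)=f(S\cup\Omega)-f(S)$, and $\rho_\omega=\rho_{\{\omega\}}$. The curvature of $f$ is the smallest scalar $\alpha$ such that $\rho_\omega((S\cup\Omega)\setminus\{\omega\})\ge(1-\alpha)\,\rho_\omega(S\setminus\{\omega\})$ for all $S,\Omega\subseteq V$ and all $\omega\in S\setminus\Omega$. A set $S$ is feasible if $|S\cap B_i|\le d_i$ for all $i$. A feasible $U$ is an $\varepsilon$-approximation if $f(U)/f(\mathrm{OPT})\ge\varepsilon$, where $\mathrm{OPT}$ is an optimal feasible set; an algorithm is an $\varepsilon$-approximation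 algorithm if its output always is. \textsc{Greedy}: start with $S=\emptyset$; repeatedly (until $|S|=d$) choose $\omega\in V$ maximizing $f(S\cup\{\omega\})-f(S)$ among those $\omega$ with $S\cup\{\omega\}$ feasible, and set $S\gets S\cup\{\omega\}$; return $S$.
   Formalization: The blocks B_i are additionally assumed to cover V (otherwise feasible sets larger than d exist and the ratio can fail); Greedy chooses only elements outside S, k ≥ 1, and at α = 0 the ratio is read as its limit, min d_i / d. *)

theory Defs
  imports Complex_Main "HOL-Library.Disjoint_Sets"
begin

section \<open>Set functions\<close>

definition subadditive_on :: "'a set \<Rightarrow> ('a set \<Rightarrow> real) \<Rightarrow> bool" where
  "subadditive_on V f \<longleftrightarrow> (\<forall>U W. U \<subseteq> V \<longrightarrow> W \<subseteq> V \<longrightarrow> f U + f W \<ge> f (U \<union> W))"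

definition monotone_set_fun :: "'a set \<Rightarrow> ('a set \<Rightarrow> real) \<Rightarrow> bool" where
  "monotone_set_fun V f \<longleftrightarrow> (\<forall>S T. S \<subseteq> T \<longrightarrow> T \<subseteq> V \<longrightarrow> f S \<le> f T)"

definition marginal :: "('a set \<Rightarrow> real) \<Rightarrow> 'a set \<Rightarrow> 'a set \<Rightarrow> real" where
  "marginal f \<Omega> S = f (S \<union> \<Omega>) - f S"

definition curvature_bound :: "'a set \<Rightarrow> ('a set \<Rightarrow> real) \<Rightarrow> real \<Rightarrow> bool" where
  "curvature_bound V f \<alpha> \<longleftrightarrow>
     (\<forall>S \<Omega>. S \<subseteq> V \<longrightarrow> \<Omega> \<subseteq> V \<longrightarrow>
        (\<forall>\<omega> \<in> S - \<Omega>.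
           marginal f {\<omega>} ((S \<union> \<Omega>) - {\<omega>}) \<ge> (1 - \<alpha>) * marginal f {\<omega>} (S - {\<omega>})))"

definition is_curvature :: "'a set \<Rightarrow> ('a set \<Rightarrow> real) \<Rightarrow> real \<Rightarrow> bool" where
  "is_curvature V f \<alpha> \<longleftrightarrow>
     curvature_bound V f \<alpha> \<and> (\<forall>\<beta>. curvature_bound V f \<beta> \<longrightarrow> \<alpha> \<le> \<beta>)"

section \<open>The constrained maximization problem\<close>

definition feasible ::
  "'a set \<Rightarrow> nat \<Rightarrow> (nat \<Rightarrow> 'a set) \<Rightarrow> (nat \<Rightarrow> nat) \<Rightarrow> 'a set \<Rightarrow> bool" where
  "feasible V k B ds S \<longleftrightarrow> S \<subseteq> V \<and> (\<forall>i \<in> {1..k}. card (S \<inter> B i) \<le> ds i)"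

definition optimal ::
  "'a set \<Rightarrow> nat \<Rightarrow> (nat \<Rightarrow> 'a set) \<Rightarrow> (nat \<Rightarrow> nat) \<Rightarrow> ('a set \<Rightarrow> real) \<Rightarrow> 'a set \<Rightarrow> bool" where
  "optimal V k B ds f S \<longleftrightarrow>
     feasible V k B ds S \<and> (\<forall>T. feasible V k B ds T \<longrightarrow> f T \<le> f S)"

definition eps_approximation ::
  "'a set \<Rightarrow> nat \<Rightarrow> (nat \<Rightarrow> 'a set) \<Rightarrow> (nat \<Rightarrow> nat) \<Rightarrow> ('a set \<Rightarrow> real) \<Rightarrow> real \<Rightarrow> 'a set \<Rightarrow> bool"
  where
  "eps_approximation V k B ds f \<epsilon> U \<longleftrightarrow>
     feasible V k B ds U \<and> (\<forall>OPT. optimal V k B ds f OPT \<longrightarrow> f U / f OPT \<ge> \<epsilon>)"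

section \<open>Computations with a value oracle\<close>

text \<open>
  A computation sees the set function only through its queries. It ends by returning an
  arbitrarily chosen element of a set (this models unspecified tie-breaking), and it is stuck
  if that set is empty.
\<close>

datatype ('a, 'r) oracle_prog =
    Pick "'r set"
  | Query "'a set" "real \<Rightarrow> ('a, 'r) oracle_prog"

text \<open>\<open>exec f p r t\<close>: some execution of \<open>p\<close> with oracle \<open>f\<close> returns \<open>r\<close> after \<open>t\<close> oracle calls.\<close>

inductive exec :: "('a set \<Rightarrow> real) \<Rightarrow> ('a, 'r) oracle_prog \<Rightarrow> 'r \<Rightarrow> nat \<Rightarrow> bool"
  for f :: "'a set \<Rightarrow> real" where
  exec_Pick: "r \<in> R \<Longrightarrow> exec f (Pick R) r 0"
| exec_Query: "exec f (p (f U)) r t \<Longrightarrow> exec f (Query U p) r (Suc t)"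

inductive while_exec ::
  "('a set \<Rightarrow> real) \<Rightarrow> ('s \<Rightarrow> bool) \<Rightarrow> ('s \<Rightarrow> ('a, 's) oracle_prog) \<Rightarrow> 's \<Rightarrow> 's \<Rightarrow> nat \<Rightarrow> bool"
  for f :: "'a set \<Rightarrow> real" and b :: "'s \<Rightarrow> bool" and body :: "'s \<Rightarrow> ('a, 's) oracle_prog" where
  while_exec_stop: "\<not> b s \<Longrightarrow> while_exec f b body s s 0"
| while_exec_iter:
    "b s \<Longrightarrow> exec f (body s) s' t \<Longrightarrow> while_exec f b body s' r t'
      \<Longrightarrow> while_exec f b body s r (t + t')"

text \<open>Every execution of the loop is finite and none gets stuck.\<close>

inductive while_halts ::
  "('a set \<Rightarrow> real) \<Rightarrow> ('s \<Rightarrow> bool) \<Rightarrow> ('s \<Rightarrow> ('a, 's) oracle_prog) \<Rightarrow> 's \<Rightarrow> bool"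
  for f :: "'a set \<Rightarrow> real" and b :: "'s \<Rightarrow> bool" and body :: "'s \<Rightarrow> ('a, 's) oracle_prog" where
  while_halts_stop: "\<not> b s \<Longrightarrow> while_halts f b body s"
| while_halts_iter:
    "b s \<Longrightarrow> \<exists>s' t. exec f (body s) s' t
      \<Longrightarrow> (\<And>s' t. exec f (body s) s' t \<Longrightarrow> while_halts f b body s')
      \<Longrightarrow> while_halts f b body s"

fun query_all ::
  "'a set list \<Rightarrow> (real list \<Rightarrow> ('a, 'r) oracle_prog) \<Rightarrow> ('a, 'r) oracle_prog" where
  "query_all [] p = p []"
| "query_all (U # Us) p = Query U (\<lambda>v. query_all Us (\<lambda>vs. p (v # vs)))"

section \<open>Greedy\<close>

text \<open>
  The list \<open>vs\<close> enumerates the ground set. Only elements outside the current set are candidates: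
  re-adding an element would leave the set unchanged, and the loop would not terminate.
\<close>

definition greedy_candidates ::
  "'a list \<Rightarrow> nat \<Rightarrow> (nat \<Rightarrow> 'a set) \<Rightarrow> (nat \<Rightarrow> nat) \<Rightarrow> 'a set \<Rightarrow> 'a list" where
  "greedy_candidates vs k B ds S =
     filter (\<lambda>\<omega>. \<omega> \<notin> S \<and> feasible (set vs) k B ds (S \<union> {\<omega>})) vs"

definition greedy_step ::
  "'a list \<Rightarrow> nat \<Rightarrow> (nat \<Rightarrow> 'a set) \<Rightarrow> (nat \<Rightarrow> nat) \<Rightarrow> 'a set \<Rightarrow> ('a, 'a set) oracle_prog" where
  "greedy_step vs k B ds S =
     (let cs = greedy_candidates vs k B ds S in
      Query S (\<lambda>v. query_all (map (\<lambda>\<omega>. S \<union> {\<omega>}) cs) (\<lambda>ws.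
        let gains = map (\<lambda>w. w - v) ws in
        Pick {S \<union> {cs ! j} | j. j < length cs \<and> gains ! j = Max (set gains)})))"

definition greedy_exec ::
  "'a list \<Rightarrow> nat \<Rightarrow> (nat \<Rightarrow> 'a set) \<Rightarrow> (nat \<Rightarrow> nat) \<Rightarrow> ('a set \<Rightarrow> real) \<Rightarrow> 'a set \<Rightarrow> nat \<Rightarrow> bool"
  where
  "greedy_exec vs k B ds f U t \<longleftrightarrow>
     while_exec f (\<lambda>S. card S \<noteq> (\<Sum>i=1..k. ds i)) (greedy_step vs k B ds) {} U t"

definition greedy_halts ::
  "'a list \<Rightarrow> nat \<Rightarrow> (nat \<Rightarrow> 'a set) \<Rightarrow> (nat \<Rightarrow> nat) \<Rightarrow> ('a set \<Rightarrow> real) \<Rightarrow> bool" where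
  "greedy_halts vs k B ds f \<longleftrightarrow>
     while_halts f (\<lambda>S. card S \<noteq> (\<Sum>i=1..k. ds i)) (greedy_step vs k B ds) {}"

text \<open>
  For \<open>\<alpha> = 0\<close> the expression \<open>1 / \<alpha>\<close> is not meaningful; the value there is the limit
  for \<open>\<alpha>\<close> tending to 0, with \<open>m\<close> the minimum of the bounds and \<open>d\<close> their sum.
\<close>

definition greedy_ratio :: "real \<Rightarrow> nat \<Rightarrow> nat \<Rightarrow> real" where
  "greedy_ratio \<alpha> m d =
     (if \<alpha> = 0 then real m / real d
      else 1 / \<alpha> * (1 - exp ((\<alpha>\<^sup>2 - \<alpha>) * real m / real d)))"

end

theory Submission
  imports Defs
begin

text \<open>
  Let \<open>T\<close> be a feasible set. While Greedy holds a set \<open>S\<close> with fewer than \<open>dmin\<close> elements, every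
  element of \<open>V\<close> outside \<open>S\<close> is a candidate. Subadditivity bounds the deficit
  \<open>R = f (T \<union> S) - f S\<close> by the sum of \<open>f {\<omega>}\<close> over \<open>\<omega> \<in> T - S\<close>, and curvature gives
  \<open>(1 - \<alpha>) * f {\<omega>} \<le> f (S \<union> {\<omega>}) - f S\<close>, so the greedy gain \<open>\<rho>\<close> satisfies
  \<open>(1 - \<alpha>) * R \<le> m * \<rho>\<close> with \<open>m = d - card (S \<inter> T)\<close>. A step to an element outside \<open>T\<close> lowers
  \<open>R\<close> by at most \<open>\<alpha> * \<rho>\<close> and keeps \<open>m\<close>; a step into \<open>T\<close> lowers \<open>R\<close> by \<open>\<rho>\<close> and \<open>m\<close> by one.
  With \<open>s\<close> steps left before \<open>dmin\<close>, the quantity \<open>f S + R * greedy_gain \<alpha> m s\<close> therefore never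
  decreases: the first kind of step is the recurrence that defines \<open>greedy_gain\<close>, and the second
  is never worse than the first.
\<close>

section \<open>The guaranteed fraction\<close>

text \<open>For \<open>m > 0\<close> and \<open>\<alpha> \<noteq> 0\<close> this is
  \<open>(1 - (1 - \<alpha> * (1 - \<alpha>) / m) ^ s) / \<alpha>\<close>. The geometric sum also
  covers \<open>\<alpha> = 0\<close>, where it equals \<open>s / m\<close>.\<close>

definition greedy_gain :: "real \<Rightarrow> nat \<Rightarrow> nat \<Rightarrow> real" where
  "greedy_gain \<alpha> m s = (1 - \<alpha>) / real m * (\<Sum>i<s. (1 - \<alpha> * (1 - \<alpha>) / real m) ^ i)"

lemma greedy_gain_0 [simp]: "greedy_gain \<alpha> m 0 = 0"
  by (simp add: greedy_gain_def)

lemma greedy_gain_Suc: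
  "greedy_gain \<alpha> m (Suc s) =
     (1 - \<alpha>) / real m + (1 - \<alpha> * (1 - \<alpha>) / real m) * greedy_gain \<alpha> m s"
  unfolding greedy_gain_def sum.lessThan_Suc_shift
  by (simp add: sum_distrib_left[symmetric] distrib_left mult.left_commute)

lemma contraction_factor_bounds:
  fixes \<alpha> :: real
  assumes "0 \<le> \<alpha>" "\<alpha> \<le> 1"
  shows "0 \<le> 1 - \<alpha> * (1 - \<alpha>) / real m" "1 - \<alpha> * (1 - \<alpha>) / real m \<le> 1"
proof -
  have a: "0 \<le> \<alpha> * (1 - \<alpha>)" "\<alpha> * (1 - \<alpha>) \<le> 1"
    using assms by (auto intro: mult_le_one)
  show "1 - \<alpha> * (1 - \<alpha>) / real m \<le> 1"
    using a by simp
  show "0 \<le> 1 - \<alpha> * (1 - \<alpha>) / real m"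
    using a by (cases "m = 0") (auto simp: divide_le_eq intro: order_trans)
qed

lemma greedy_gain_nonneg:
  assumes "0 \<le> \<alpha>" "\<alpha> \<le> 1"
  shows "0 \<le> greedy_gain \<alpha> m s"
  unfolding greedy_gain_def using assms contraction_factor_bounds[OF assms, of m]
  by (intro mult_nonneg_nonneg sum_nonneg zero_le_power) auto

lemma greedy_gain_le_1:
  assumes "0 \<le> \<alpha>" "\<alpha> \<le> 1" "s \<le> m"
  shows "greedy_gain \<alpha> m s \<le> 1"
proof (cases "m = 0")
  case False
  have "(\<Sum>i<s. (1 - \<alpha> * (1 - \<alpha>) / real m) ^ i) \<le> (\<Sum>i<s. 1)"
    by (intro sum_mono power_le_one contraction_factor_bounds assms)
  also have "\<dots> \<le> real m"
    using assms by simp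
  finally have "greedy_gain \<alpha> m s \<le> (1 - \<alpha>) / real m * real m"
    unfolding greedy_gain_def using assms by (intro mult_left_mono) auto
  also have "\<dots> \<le> 1"
    using False assms by simp
  finally show ?thesis .
qed (simp add: greedy_gain_def)

text \<open>The extra factor on the left makes up for the larger base. With \<open>x\<close> and
  \<open>y\<close> as in the proof, \<open>y - x = (1 - y) / N\<close> and
  \<open>i / N \<le> 1 - 1 / N \<le> y\<close>, so \<open>i * (y - x) \<le> (1 - y) * y\<close>.
  Divided by \<open>y\<close>, this reads \<open>y \<le> 1 + i * (x / y - 1)\<close>, and
  Bernoulli's inequality bounds the right side by \<open>(x / y) ^ i\<close>.\<close>

lemma contraction_factor_power_mono:
  fixes a :: real
  assumes "0 \<le> a" "a < 1" "i < N"
  shows "(1 - a / real (Suc N)) ^ Suc i \<le> (1 - a / real N) ^ i"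
proof -
  define x y where "x = 1 - a / real N" and "y = 1 - a / real (Suc N)"
  have N: "0 < real N" using assms by simp
  have y: "0 < y" using assms by (simp add: y_def field_simps)
  have x: "0 \<le> x" using assms N by (simp add: x_def field_simps)
  have yx: "y - x = a / real (Suc N) * (1 / real N)"
    using N by (simp add: x_def y_def divide_simps) (simp add: algebra_simps)
  have "real i * (1 / real N) \<le> (real N - 1) * (1 / real N)"
    using assms by (intro mult_right_mono) auto
  also have "\<dots> = 1 - 1 / real N"
    using N by (simp add: field_simps)
  also have "\<dots> \<le> y"
    unfolding y_def using assms N by (intro diff_left_mono frac_le) auto
  finally have "a / real (Suc N) * (real i * (1 / real N)) \<le> a / real (Suc N) * y"
    using assms by (intro mult_left_mono) auto
  moreover have "a / real (Suc N) = 1 - y" by (simp add: y_def)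
  ultimately have "real i * (y - x) \<le> (1 - y) * y"
    unfolding yx by (simp only: mult_ac)
  then have key: "y * y \<le> y + real i * (x - y)"
    by (simp add: algebra_simps)
  have "y \<le> 1 + real i * (x / y - 1)"
    using key y by (simp add: field_simps)
  also have "\<dots> \<le> (1 + (x / y - 1)) ^ i"
    using x y by (intro Bernoulli_inequality) simp
  also have "\<dots> = (x / y) ^ i" by simp
  finally show ?thesis
    using y unfolding x_def[symmetric] y_def[symmetric]
    by (simp add: power_divide field_simps)
qed

text \<open>This is the comparison of a step into \<open>T\<close> (right) with a step outside it
  (left), after the common summand \<open>(1 - \<alpha>) / m\<close> is cancelled. The powers
  compare term by term, and the prefactors compare because
  \<open>(m - 1) / m = 1 - 1 / m \<le> 1 - (1 - \<alpha>) / m\<close>.\<close>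

lemma greedy_gain_overlap:
  assumes \<alpha>: "0 \<le> \<alpha>" "\<alpha> \<le> 1" and "s < m"
  shows "(1 - \<alpha> * (1 - \<alpha>) / real m) * greedy_gain \<alpha> m s
           \<le> (1 - (1 - \<alpha>) / real m) * greedy_gain \<alpha> (m - 1) s"
proof (cases "s = 0")
  case False
  define N where "N = m - 1"
  have m: "m = Suc N" and N: "s \<le> N" "0 < real N"
    using \<open>s < m\<close> False by (auto simp: N_def)
  define a where "a = \<alpha> * (1 - \<alpha>)"
  define X where "X = (\<Sum>i<s. (1 - a / real N) ^ i)"
  have a: "0 \<le> a" "a < 1"
  proof -
    show "0 \<le> a" using \<alpha> by (simp add: a_def)
    \<comment> \<open>Completing the square gives \<open>a \<le> 1/4\<close>, hence the strict bound
      that the power comparison asks for.\<close>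
    have "a + (\<alpha> - 1/2)\<^sup>2 = 1/4" by (simp add: a_def power2_eq_square algebra_simps)
    then show "a < 1" using zero_le_power2[of "\<alpha> - 1/2"] by linarith
  qed
  have "(1 - a / real m) * (\<Sum>i<s. (1 - a / real m) ^ i) = (\<Sum>i<s. (1 - a / real m) ^ Suc i)"
    by (simp add: sum_distrib_left)
  also have "\<dots> \<le> X"
    unfolding X_def m using N a by (intro sum_mono contraction_factor_power_mono) auto
  finally have le_X: "(1 - a / real m) * (\<Sum>i<s. (1 - a / real m) ^ i) \<le> X" .
  have X: "0 \<le> X"
    unfolding X_def a_def by (intro sum_nonneg zero_le_power contraction_factor_bounds \<alpha>)
  have "(1 - a / real m) * greedy_gain \<alpha> m s
          = (1 - \<alpha>) / real m * ((1 - a / real m) * (\<Sum>i<s. (1 - a / real m) ^ i))"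
    by (simp add: greedy_gain_def a_def)
  also have "\<dots> \<le> (1 - \<alpha>) / real m * X"
    using \<alpha> le_X by (intro mult_left_mono) auto
  also have "\<dots> \<le> (1 - (1 - \<alpha>) / real m) * ((1 - \<alpha>) / real N) * X"
  proof (intro mult_right_mono X)
    have "(1 - \<alpha>) / real m = real N / real m * ((1 - \<alpha>) / real N)"
      using N by simp
    also have "\<dots> \<le> (1 - (1 - \<alpha>) / real m) * ((1 - \<alpha>) / real N)"
      using \<alpha> N by (intro mult_right_mono) (auto simp: m field_simps)
    finally show "(1 - \<alpha>) / real m \<le> (1 - (1 - \<alpha>) / real m) * ((1 - \<alpha>) / real N)" .
  qed
  also have "\<dots> = (1 - (1 - \<alpha>) / real m) * greedy_gain \<alpha> (m - 1) s"
    by (simp add: greedy_gain_def X_def a_def N_def)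
  finally show ?thesis by (simp add: a_def)
qed simp

text \<open>Summing the geometric series turns the gain into
  \<open>1 / \<alpha> * (1 - (1 - x) ^ m)\<close>; then
  \<open>1 - x \<le> exp (- x)\<close>.\<close>

lemma greedy_ratio_le_greedy_gain:
  assumes "0 \<le> \<alpha>" "\<alpha> \<le> 1"
  shows "greedy_ratio \<alpha> m d \<le> greedy_gain \<alpha> d m"
proof (cases "\<alpha> = 0 \<or> \<alpha> = 1 \<or> d = 0")
  \<comment> \<open>Here the ratio of the series is 1 and its closed form breaks down. Both sides
    then coincide: \<open>m / d\<close> for \<open>\<alpha> = 0\<close>, and 0 for
    \<open>\<alpha> = 1\<close>; for \<open>d = 0\<close> division by zero makes both 0.\<close>
  case True
  then show ?thesis by (auto simp: greedy_ratio_def greedy_gain_def)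
next
  case False
  define x where "x = \<alpha> * (1 - \<alpha>) / real d"
  have x: "x \<noteq> 0" using False by (simp add: x_def)
  have "greedy_gain \<alpha> d m = x / \<alpha> * (\<Sum>i<m. (1 - x) ^ i)"
    using False by (simp add: greedy_gain_def x_def)
  also have "(\<Sum>i<m. (1 - x) ^ i) = (1 - (1 - x) ^ m) / x"
    using x by (simp add: sum_gp_strict)
  finally have gain: "greedy_gain \<alpha> d m = 1 / \<alpha> * (1 - (1 - x) ^ m)"
    using x by simp
  have "(1 - x) ^ m \<le> exp (- x) ^ m"
    using contraction_factor_bounds[OF assms, of d] exp_ge_add_one_self[of "- x"]
    by (intro power_mono) (auto simp: x_def)
  also have "\<dots> = exp (real m * (- x))"
    by (rule exp_of_nat_mult[symmetric])
  also have "real m * (- x) = (\<alpha>\<^sup>2 - \<alpha>) * real m / real d"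
    by (simp add: x_def power2_eq_square algebra_simps diff_divide_distrib)
  finally have "1 / \<alpha> * (1 - exp ((\<alpha>\<^sup>2 - \<alpha>) * real m / real d)) \<le> 1 / \<alpha> * (1 - (1 - x) ^ m)"
    using assms by (intro mult_left_mono) auto
  then show ?thesis using False gain by (simp add: greedy_ratio_def)
qed

text \<open>Once \<open>R'\<close> is replaced by its lower bound, the right side is linear in
  \<open>\<rho>\<close> with coefficient \<open>1 - \<alpha> * g\<close> or \<open>1 - g\<close>,
  where \<open>g\<close> is the gain after the step. Since \<open>0 \<le> g \<le> 1\<close>, this
  coefficient is nonnegative and \<open>\<rho>\<close> may be replaced by
  \<open>(1 - \<alpha>) / m * R\<close>. The first case then is the recurrence
  \<open>greedy_gain_Suc\<close>; the second also needs \<open>greedy_gain_overlap\<close>.\<close>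

lemma greedy_potential_step:
  fixes R R' \<rho> :: real
  assumes \<alpha>: "0 \<le> \<alpha>" "\<alpha> \<le> 1" and "s < m"
    and gain: "(1 - \<alpha>) * R \<le> real m * \<rho>" and "0 \<le> R"
    and step: "R - \<alpha> * \<rho> \<le> R' \<and> m' = m \<or> R - \<rho> \<le> R' \<and> m' = m - 1"
  shows "R * greedy_gain \<alpha> m (Suc s) \<le> \<rho> + R' * greedy_gain \<alpha> m' s"
  using step
proof (elim disjE conjE)
  have \<rho>: "(1 - \<alpha>) / real m * R \<le> \<rho>"
    using gain \<open>s < m\<close> by (simp add: field_simps)
  {
    assume R': "R - \<alpha> * \<rho> \<le> R'" and [simp]: "m' = m"
    let ?g = "greedy_gain \<alpha> m s"
    have g: "0 \<le> ?g" "?g \<le> 1"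
      using \<alpha> \<open>s < m\<close> by (auto intro: greedy_gain_nonneg greedy_gain_le_1)
    have "\<alpha> * ?g \<le> 1" using \<alpha> g by (intro mult_le_one) auto
    then have "(1 - \<alpha>) / real m * R * (1 - \<alpha> * ?g) \<le> \<rho> * (1 - \<alpha> * ?g)"
      by (intro mult_right_mono \<rho>) simp
    moreover have "(R - \<alpha> * \<rho>) * ?g \<le> R' * ?g"
      by (intro mult_right_mono R' g)
    ultimately show ?thesis
      by (simp add: greedy_gain_Suc algebra_simps add_divide_distrib diff_divide_distrib)
  next
    assume R': "R - \<rho> \<le> R'" and [simp]: "m' = m - 1"
    let ?g = "greedy_gain \<alpha> (m - 1) s"
    \<comment> \<open>The bound by 1 needs \<open>s \<le> m - 1\<close>, which is why
      \<open>s < m\<close> is assumed.\<close>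
    have g: "0 \<le> ?g" "?g \<le> 1"
      using \<alpha> \<open>s < m\<close> by (auto intro: greedy_gain_nonneg greedy_gain_le_1)
    have "(1 - \<alpha>) / real m * R * (1 - ?g) \<le> \<rho> * (1 - ?g)"
      by (intro mult_right_mono \<rho>) (use g in simp)
    moreover have "(R - \<rho>) * ?g \<le> R' * ?g"
      by (intro mult_right_mono R' g)
    moreover have "R * ((1 - \<alpha> * (1 - \<alpha>) / real m) * greedy_gain \<alpha> m s)
                     \<le> R * ((1 - (1 - \<alpha>) / real m) * ?g)"
      using assms by (intro mult_left_mono greedy_gain_overlap) auto
    ultimately show ?thesis
      by (simp add: greedy_gain_Suc algebra_simps add_divide_distrib diff_divide_distrib)
  }
qed

section \<open>Set functions of bounded curvature\<close>

lemma subadditive_on_union_le_sum: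
  assumes "subadditive_on V f" "S \<subseteq> V" "finite A" "A \<subseteq> V"
  shows "f (S \<union> A) \<le> f S + (\<Sum>\<omega>\<in>A. f {\<omega>})"
  using assms(3,4)
proof (induction A rule: finite_induct)
  case (insert \<omega> A)
  have "f ((S \<union> A) \<union> {\<omega>}) \<le> f (S \<union> A) + f {\<omega>}"
    using assms(1,2) insert.prems
    by (auto simp del: Un_insert_right simp: subadditive_on_def)
  then show ?case using insert by simp
qed simp

text \<open>Diminishing returns up to the factor \<open>1 - \<alpha>\<close>: the definition is
  applied to \<open>insert \<omega> S\<close> and \<open>T\<close>, and removing
  \<open>\<omega>\<close> again leaves \<open>T\<close> and \<open>S\<close>.\<close>

lemma curvature_boundD:
  assumes "curvature_bound V f \<alpha>" "S \<subseteq> T" "T \<subseteq> V" "\<omega> \<in> V - T"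
  shows "(1 - \<alpha>) * (f (insert \<omega> S) - f S) \<le> f (insert \<omega> T) - f T"
proof -
  have *: "insert \<omega> S \<union> T - {\<omega>} = T" "insert \<omega> S - {\<omega>} = S"
    using assms by auto
  have "marginal f {\<omega>} ((insert \<omega> S \<union> T) - {\<omega>})
          \<ge> (1 - \<alpha>) * marginal f {\<omega>} (insert \<omega> S - {\<omega>})"
    using assms(1)[unfolded curvature_bound_def, rule_format, of "insert \<omega> S" T \<omega>] assms(2-4)
    by auto
  then show ?thesis unfolding * by (simp add: marginal_def)
qed

text \<open>For the zero function every real number is a curvature bound, so there is no smallest one.\<close>

lemma is_curvature_nonzero:
  assumes "is_curvature V f \<alpha>"
  shows "\<exists>S\<subseteq>V. f S \<noteq> 0"
proof (rule ccontr)
  assume "\<not> (\<exists>S\<subseteq>V. f S \<noteq> 0)"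
  then have zero: "f S = 0" if "S \<subseteq> V" for S using that by blast
  have "marginal f {\<omega>} S = 0" if "S \<subseteq> V" "\<omega> \<in> V" for \<omega> S
    using that zero[of S] zero[of "S \<union> {\<omega>}"] by (simp add: marginal_def)
  then have "marginal f {\<omega>} (S \<union> \<Omega> - {\<omega>}) = 0" "marginal f {\<omega>} (S - {\<omega>}) = 0"
    if "S \<subseteq> V" "\<Omega> \<subseteq> V" "\<omega> \<in> S - \<Omega>" for S \<Omega> \<omega>
    using that by (metis Diff_iff Diff_subset Un_least order_trans subsetD)+
  \<comment> \<open>A bound smaller than \<open>\<alpha>\<close> contradicts minimality.\<close>
  then have "curvature_bound V f (\<alpha> - 1)"
    unfolding curvature_bound_def by simp
  then show False using assms unfolding is_curvature_def by force
qed

section \<open>Executions\<close>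

inductive_cases exec_PickE: "exec f (Pick R) r t"
inductive_cases exec_QueryE: "exec f (Query U p) r t"

lemma exec_Pick_iff: "exec f (Pick R) r t \<longleftrightarrow> r \<in> R \<and> t = 0"
  by (auto elim: exec_PickE intro: exec_Pick)

lemma exec_Query_iff: "exec f (Query U p) r t \<longleftrightarrow> (\<exists>t'. t = Suc t' \<and> exec f (p (f U)) r t')"
  by (auto elim: exec_QueryE intro: exec_Query)

lemma exec_query_all_iff:
  "exec f (query_all Us p) r t \<longleftrightarrow> (\<exists>t'. t = length Us + t' \<and> exec f (p (map f Us)) r t')"
  by (induction Us arbitrary: p t) (auto simp: exec_Query_iff)

text \<open>The query beyond one per candidate is for \<open>f S\<close>. Subtracting this common
  value does not change which candidates are maximal, so gains can be traded for values.\<close>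

lemma exec_greedy_step_iff:
  fixes vs k B ds S
  defines "cs \<equiv> greedy_candidates vs k B ds S"
  shows "exec f (greedy_step vs k B ds S) S' t \<longleftrightarrow>
     t = Suc (length cs) \<and>
     (\<exists>\<omega>\<in>set cs. S' = insert \<omega> S \<and> (\<forall>\<omega>'\<in>set cs. f (insert \<omega>' S) \<le> f (insert \<omega> S)))"
proof -
  let ?gains = "map (\<lambda>\<omega>. f (insert \<omega> S) - f S) cs"
  have Max: "?gains ! j = Max (set ?gains) \<longleftrightarrow>
      (\<forall>\<omega>'\<in>set cs. f (insert \<omega>' S) \<le> f (insert (cs ! j) S))" if "j < length cs" for j
    using that by (subst eq_commute, subst Max_eq_iff) auto
  have "exec f (greedy_step vs k B ds S) S' t \<longleftrightarrow> t = Suc (length cs) \<and>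
     (\<exists>j<length cs. S' = insert (cs ! j) S \<and> ?gains ! j = Max (set ?gains))"
    unfolding greedy_step_def Let_def cs_def[symmetric]
    by (auto simp: exec_Query_iff exec_query_all_iff exec_Pick_iff o_def image_image
        cong: conj_cong)
  also have "\<dots> \<longleftrightarrow> t = Suc (length cs) \<and>
     (\<exists>j<length cs. S' = insert (cs ! j) S \<and>
        (\<forall>\<omega>'\<in>set cs. f (insert \<omega>' S) \<le> f (insert (cs ! j) S)))"
    using Max by blast
  finally show ?thesis
    by (simp only: Bex_def in_set_conv_nth) blast
qed

section \<open>Analysis of Greedy\<close>

locale greedy_problem =
  fixes vs :: "'a list" and f :: "'a set \<Rightarrow> real" and \<alpha> :: real
    and k :: nat and B :: "nat \<Rightarrow> 'a set" and ds :: "nat \<Rightarrow> nat"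
  assumes monotone: "monotone_set_fun (set vs) f"
    and subadditive: "subadditive_on (set vs) f"
    and empty [simp]: "f {} = 0"
    and curvature: "is_curvature (set vs) f \<alpha>"
    and \<alpha>: "0 \<le> \<alpha>" "\<alpha> \<le> 1"
    and k_pos: "1 \<le> k"
    and disjoint: "disjoint_family_on B {1..k}"
    and cover: "(\<Union>i\<in>{1..k}. B i) = set vs"
    and ds_bounds: "\<And>i. i \<in> {1..k} \<Longrightarrow> 1 \<le> ds i \<and> ds i \<le> card (B i)"
begin

abbreviation "V \<equiv> set vs"
abbreviation "d \<equiv> \<Sum>i=1..k. ds i"
abbreviation "dmin \<equiv> Min (ds ` {1..k})"
abbreviation "cands \<equiv> greedy_candidates vs k B ds"
abbreviation "feas \<equiv> feasible V k B ds"

lemma mono: "S \<subseteq> T \<Longrightarrow> T \<subseteq> V \<Longrightarrow> f S \<le> f T"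
  using monotone by (auto simp: monotone_set_fun_def)

lemma curvature_ineq:
  "S \<subseteq> T \<Longrightarrow> T \<subseteq> V \<Longrightarrow> \<omega> \<in> V - T \<Longrightarrow>
     (1 - \<alpha>) * (f (insert \<omega> S) - f S) \<le> f (insert \<omega> T) - f T"
  using curvature by (intro curvature_boundD) (auto simp: is_curvature_def)

section \<open>Feasible sets and greedy candidates\<close>

lemma dmin_le: "i \<in> {1..k} \<Longrightarrow> dmin \<le> ds i"
  by simp

lemma dmin_le_d: "dmin \<le> d"
proof -
  have "dmin \<le> ds 1" using k_pos by (intro dmin_le) auto
  also have "\<dots> \<le> d" using k_pos by (intro member_le_sum) auto
  finally show ?thesis .
qed

text \<open>Here the blocks must partition the ground set: covering means no element is missed,
  disjointness that none is counted twice.\<close>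

lemma card_eq_sum_blocks:
  assumes "S \<subseteq> V"
  shows "card S = (\<Sum>i=1..k. card (S \<inter> B i))"
proof -
  have "S = (\<Union>i\<in>{1..k}. S \<inter> B i)" using assms cover by blast
  moreover have "card (\<Union>i\<in>{1..k}. S \<inter> B i) = (\<Sum>i=1..k. card (S \<inter> B i))"
  proof (rule card_UN_disjoint)
    show "\<forall>i\<in>{1..k}. finite (S \<inter> B i)"
      using assms finite_subset by blast
    show "\<forall>i\<in>{1..k}. \<forall>j\<in>{1..k}. i \<noteq> j \<longrightarrow> (S \<inter> B i) \<inter> (S \<inter> B j) = {}"
      using disjoint unfolding disjoint_family_on_def by blast
  qed simp
  ultimately show ?thesis by simp
qed

lemma feas_subset: "feas S \<Longrightarrow> S \<subseteq> V"
  by (simp add: feasible_def)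

lemma feas_card_le: "feas S \<Longrightarrow> card S \<le> d"
  by (subst card_eq_sum_blocks) (auto simp: feasible_def intro!: sum_mono)

lemma set_cands: "set (cands S) = {\<omega> \<in> V. \<omega> \<notin> S \<and> feas (insert \<omega> S)}"
  by (auto simp: greedy_candidates_def)

lemma card_insert_le_Suc: "card (insert \<omega> S) \<le> Suc (card S)"
  by (cases "finite S") (auto simp: card_insert_if)

text \<open>As \<open>card S < d\<close>, some block is below its limit, and this limit is at most
  the size of the block, so the block has an element outside \<open>S\<close>. By disjointness that
  element counts against no other limit.\<close>

lemma candidate_exists:
  assumes S: "feas S" and "card S \<noteq> d"
  shows "set (cands S) \<noteq> {}"
proof -
  have "card S < d" using feas_card_le[OF S] assms by simp
  then have "\<not> (\<forall>i\<in>{1..k}. ds i \<le> card (S \<inter> B i))"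
    using card_eq_sum_blocks[OF feas_subset[OF S]] sum_mono[of "{1..k}" ds "\<lambda>i. card (S \<inter> B i)"]
    by force
  then obtain i where i: "i \<in> {1..k}" "card (S \<inter> B i) < ds i" by force
  have "card (S \<inter> B i) < card (B i)" using i ds_bounds[of i] by linarith
  then obtain \<omega> where \<omega>: "\<omega> \<in> B i" "\<omega> \<notin> S"
    by (metis inf.absorb2 less_irrefl subsetI)
  have "card (insert \<omega> S \<inter> B j) \<le> ds j" if j: "j \<in> {1..k}" for j
  proof (cases "j = i")
    case True
    have "insert \<omega> S \<inter> B i = insert \<omega> (S \<inter> B i)" using \<omega> by blast
    then have "card (insert \<omega> S \<inter> B i) \<le> Suc (card (S \<inter> B i))"
      using card_insert_le_Suc by metis
    then show ?thesis using True i by simp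
  next
    case False
    then have "\<omega> \<notin> B j"
      using \<omega> i j disjoint unfolding disjoint_family_on_def by blast
    then show ?thesis using S j by (simp add: feasible_def)
  qed
  moreover have "\<omega> \<in> V" using i \<omega> cover by blast
  ultimately have "\<omega> \<in> set (cands S)"
    using \<omega> feas_subset[OF S] by (auto simp: set_cands feasible_def)
  then show ?thesis by auto
qed

text \<open>After one more element the whole set has at most \<open>dmin\<close> elements, so it
  cannot violate the limit of any block.\<close>

lemma all_candidates:
  assumes "S \<subseteq> V" "card S < dmin" "\<omega> \<in> V - S"
  shows "\<omega> \<in> set (cands S)"
proof -
  have "card (insert \<omega> S \<inter> B i) \<le> ds i" if "i \<in> {1..k}" for i
  proof -
    have "card (insert \<omega> S \<inter> B i) \<le> card (insert \<omega> S)"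
      using assms by (intro card_mono) (auto intro: finite_subset)
    also have "\<dots> \<le> Suc (card S)" by (rule card_insert_le_Suc)
    also have "\<dots> \<le> ds i" using assms(2) dmin_le[OF that] by linarith
    finally show ?thesis .
  qed
  then show ?thesis using assms by (auto simp: set_cands feasible_def)
qed

section \<open>Progress and termination of the loop\<close>

lemma step_card:
  assumes "feas S" "\<omega> \<in> set (cands S)"
  shows "card (insert \<omega> S) = Suc (card S)"
  using assms by (auto simp: set_cands dest!: feas_subset intro!: card_insert_disjoint
      intro: finite_subset)

text \<open>Every iteration adds a new element, so \<open>d - card S\<close> decreases. The loop is
  never stuck because the finite nonempty set of candidates has a maximizer.\<close>

lemma greedy_halts_from:
  assumes "feas S"
  shows "while_halts f (\<lambda>S. card S \<noteq> d) (greedy_step vs k B ds) S"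
  using assms
proof (induction "d - card S" arbitrary: S rule: less_induct)
  case less
  show ?case
  proof (cases "card S = d")
    case False
    let ?C = "set (cands S)"
    have lt: "card S < d" using False feas_card_le[OF less.prems] by simp
    obtain \<omega> where "\<omega> \<in> ?C" "Max ((\<lambda>\<omega>. f (insert \<omega> S)) ` ?C) = f (insert \<omega> S)"
      using obtains_MAX[of ?C "\<lambda>\<omega>. f (insert \<omega> S)"] candidate_exists[OF less.prems False]
      by (metis List.finite_set)
    then have ex: "\<exists>s' t. exec f (greedy_step vs k B ds S) s' t"
      unfolding exec_greedy_step_iff by (metis List.finite_set Max_ge finite_imageI imageI)
    show ?thesis
    proof (rule while_halts_iter)
      fix S' t assume "exec f (greedy_step vs k B ds S) S' t"
      then obtain \<omega> where \<omega>: "\<omega> \<in> ?C" "S' = insert \<omega> S"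
        by (auto simp: exec_greedy_step_iff)
      show "while_halts f (\<lambda>S. card S \<noteq> d) (greedy_step vs k B ds) S'"
        using \<omega> lt step_card[OF less.prems, of \<omega>]
        by (intro less.hyps) (auto simp: set_cands)
    qed (use False ex in auto)
  qed (simp add: while_halts_stop)
qed

section \<open>The potential along a run\<close>

lemma greedy_increment_bound:
  assumes T: "feas T" and S: "feas S" and "card S < dmin"
    and \<omega>: "\<forall>\<omega>'\<in>set (cands S). f (insert \<omega>' S) \<le> f (insert \<omega> S)"
    and \<rho>: "0 \<le> f (insert \<omega> S) - f S"
  shows "(1 - \<alpha>) * (f (T \<union> S) - f S) \<le> real (d - card (S \<inter> T)) * (f (insert \<omega> S) - f S)"
proof -
  note sub = feas_subset[OF T] feas_subset[OF S]
  have fin: "finite T" "finite S" using sub finite_subset by auto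
  let ?\<rho> = "f (insert \<omega> S) - f S"
  have "f (S \<union> (T - S)) \<le> f S + (\<Sum>\<omega>\<in>T - S. f {\<omega>})"
    using sub fin by (intro subadditive_on_union_le_sum[OF subadditive]) auto
  moreover have "S \<union> (T - S) = T \<union> S" by blast
  ultimately have "f (T \<union> S) - f S \<le> (\<Sum>\<omega>\<in>T - S. f {\<omega>})" by simp
  then have "(1 - \<alpha>) * (f (T \<union> S) - f S) \<le> (1 - \<alpha>) * (\<Sum>\<omega>\<in>T - S. f {\<omega>})"
    using \<alpha> by (intro mult_left_mono) auto
  also have "\<dots> = (\<Sum>\<omega>\<in>T - S. (1 - \<alpha>) * f {\<omega>})"
    by (rule sum_distrib_left)
  also have "\<dots> \<le> (\<Sum>\<omega>\<in>T - S. ?\<rho>)"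
  proof (rule sum_mono)
    fix \<omega>' assume \<omega>': "\<omega>' \<in> T - S"
    have "(1 - \<alpha>) * f {\<omega>'} \<le> f (insert \<omega>' S) - f S"
      using curvature_ineq[of "{}" S \<omega>'] sub \<omega>' by auto
    also have "\<dots> \<le> ?\<rho>"
      using \<omega> all_candidates[of S \<omega>'] assms(3) sub \<omega>' by auto
    finally show "(1 - \<alpha>) * f {\<omega>'} \<le> ?\<rho>" .
  qed
  also have "\<dots> = real (card (T - S)) * ?\<rho>" by simp
  \<comment> \<open>\<open>T\<close> may have fewer than \<open>d\<close> elements; counting it as
    \<open>d\<close> only enlarges the factor of \<open>\<rho> \<ge> 0\<close>.\<close>
  also have "\<dots> \<le> real (d - card (S \<inter> T)) * ?\<rho>"
  proof (intro mult_right_mono \<rho>)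
    have "card (T - S) = card T - card (S \<inter> T)"
      using fin by (simp add: card_Diff_subset_Int Int_commute)
    then show "real (card (T - S)) \<le> real (d - card (S \<inter> T))"
      using feas_card_le[OF T] by simp
  qed
  finally show ?thesis .
qed

lemma greedy_invariant_step:
  assumes T: "feas T" and S: "feas S" and cand: "\<omega> \<in> set (cands S)"
    and \<omega>: "\<forall>\<omega>'\<in>set (cands S). f (insert \<omega>' S) \<le> f (insert \<omega> S)"
  defines "\<Phi> \<equiv> \<lambda>S. f S + (f (T \<union> S) - f S) * greedy_gain \<alpha> (d - card (S \<inter> T)) (dmin - card S)"
  shows "\<Phi> S \<le> \<Phi> (insert \<omega> S)"
proof -
  note sub = feas_subset[OF T] feas_subset[OF S]
  have fin: "finite S" using sub finite_subset by auto
  have \<omega>V: "\<omega> \<in> V" "\<omega> \<notin> S" using cand by (auto simp: set_cands)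
  have \<rho>: "0 \<le> f (insert \<omega> S) - f S"
    using mono[of S "insert \<omega> S"] sub \<omega>V by auto
  show ?thesis
  proof (cases "card S < dmin")
    \<comment> \<open>Truncated subtraction leaves zero remaining steps on both sides, so the gains
      vanish, \<open>\<Phi>\<close> agrees with \<open>f\<close>, and monotonicity suffices.\<close>
    case False
    then show ?thesis using \<rho> step_card[OF S cand] by (simp add: \<Phi>_def)
  next
    case True
    define s where "s = dmin - Suc (card S)"
    have s: "dmin - card S = Suc s" "dmin - card (insert \<omega> S) = s"
      using True step_card[OF S cand] by (auto simp: s_def)
    have "card (S \<inter> T) \<le> card S" using fin by (intro card_mono) auto
    \<comment> \<open>Indeed \<open>dmin - Suc (card S) < d - card S \<le> d - card (S \<inter>
      T)\<close>.\<close>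
    then have s_less: "s < d - card (S \<inter> T)"
      using dmin_le_d True by (simp add: s_def)
    have "(f (T \<union> S) - f S) * greedy_gain \<alpha> (d - card (S \<inter> T)) (Suc s)
       \<le> (f (insert \<omega> S) - f S)
          + (f (T \<union> insert \<omega> S) - f (insert \<omega> S)) * greedy_gain \<alpha> (d - card (insert \<omega> S \<inter> T)) s"
    proof (rule greedy_potential_step[OF \<alpha> s_less greedy_increment_bound[OF T S True \<omega> \<rho>]])
      show "0 \<le> f (T \<union> S) - f S" using mono[of S "T \<union> S"] sub by auto
      show "f (T \<union> S) - f S - \<alpha> * (f (insert \<omega> S) - f S) \<le> f (T \<union> insert \<omega> S) - f (insert \<omega> S)
              \<and> d - card (insert \<omega> S \<inter> T) = d - card (S \<inter> T) \<or>
            f (T \<union> S) - f S - (f (insert \<omega> S) - f S) \<le> f (T \<union> insert \<omega> S) - f (insert \<omega> S)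
              \<and> d - card (insert \<omega> S \<inter> T) = d - card (S \<inter> T) - 1"
      proof (cases "\<omega> \<in> T")
        case True
        \<comment> \<open>The union with \<open>T\<close> is unchanged, so the deficit falls by
          exactly \<open>\<rho>\<close> while the overlap grows by one.\<close>
        then have "T \<union> insert \<omega> S = T \<union> S" "insert \<omega> S \<inter> T = insert \<omega> (S \<inter> T)" by auto
        then show ?thesis using fin \<omega>V by simp
      next
        case False
        \<comment> \<open>Curvature, now applied to \<open>S\<close> inside
          \<open>T \<union> S\<close>: the union gains at least
          \<open>(1 - \<alpha>) * \<rho>\<close>, so the deficit falls by at most
          \<open>\<alpha> * \<rho>\<close>.\<close>
        then have "(1 - \<alpha>) * (f (insert \<omega> S) - f S) \<le> f (insert \<omega> (T \<union> S)) - f (T \<union> S)"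
          using sub \<omega>V by (intro curvature_ineq) auto
        then show ?thesis using False by (simp add: algebra_simps)
      qed
    qed
    then show ?thesis unfolding \<Phi>_def s by linarith
  qed
qed

text \<open>The start is an arbitrary feasible set so that the induction applies to the remainder of
  a run.\<close>

lemma while_exec_greedy:
  assumes "while_exec f (\<lambda>S. card S \<noteq> d) (greedy_step vs k B ds) S U t" "feas S"
  shows "feas U"
    and "t \<le> (d - card S) * Suc (length vs)"
    and "feas T \<Longrightarrow>
      f S + (f (T \<union> S) - f S) * greedy_gain \<alpha> (d - card (S \<inter> T)) (dmin - card S) \<le> f U"
proof -
  have "feas U \<and> t \<le> (d - card S) * Suc (length vs) \<and>
    (feas T \<longrightarrow>
      f S + (f (T \<union> S) - f S) * greedy_gain \<alpha> (d - card (S \<inter> T)) (dmin - card S) \<le> f U)"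
    using assms
  proof (induction rule: while_exec.induct)
    case (while_exec_stop S)
    \<comment> \<open>On exit \<open>card S = d \<ge> dmin\<close>, so the gain is 0 and only
      \<open>f S\<close> remains of the potential.\<close>
    then show ?case using dmin_le_d by simp
  next
    case (while_exec_iter S S' t U t')
    obtain \<omega> where \<omega>: "\<omega> \<in> set (cands S)" "S' = insert \<omega> S"
        "\<forall>\<omega>'\<in>set (cands S). f (insert \<omega>' S) \<le> f (insert \<omega> S)"
      and t: "t = Suc (length (cands S))"
      using while_exec_iter.hyps(2) by (auto simp: exec_greedy_step_iff)
    have S': "feas S'" using \<omega> by (simp add: set_cands)
    have card: "card S' = Suc (card S)"
      using step_card[OF while_exec_iter.prems \<omega>(1)] \<omega>(2) by simp
    \<comment> \<open>One query per candidate and one for the current set.\<close>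
    have "t \<le> Suc (length vs)"
      by (simp add: t greedy_candidates_def)
    moreover have "d - card S = Suc (d - card S')"
      using card feas_card_le[OF S'] by simp
    ultimately have "t + t' \<le> (d - card S) * Suc (length vs)"
      using while_exec_iter.IH[OF S'] by simp
    moreover have "f S + (f (T \<union> S) - f S) * greedy_gain \<alpha> (d - card (S \<inter> T)) (dmin - card S)
       \<le> f U" if "feas T"
      using greedy_invariant_step[OF that while_exec_iter.prems \<omega>(1,3)] that
        while_exec_iter.IH[OF S'] unfolding \<omega>(2)[symmetric] by linarith
    ultimately show ?case using while_exec_iter.IH[OF S'] by blast
  qed
  then show "feas U" "t \<le> (d - card S) * Suc (length vs)"
    "feas T \<Longrightarrow>
      f S + (f (T \<union> S) - f S) * greedy_gain \<alpha> (d - card (S \<inter> T)) (dmin - card S) \<le> f U"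
    by blast+
qed

section \<open>Approximation ratio and query count\<close>

lemma feas_empty: "feas {}"
  by (simp add: feasible_def)

text \<open>Needed to clear the denominator of the ratio. All limits are at least 1, so singletons
  are feasible; were the optimum not positive, subadditivity would make \<open>f\<close> vanish on
  all subsets, and then no least curvature bound exists.\<close>

lemma optimal_pos:
  assumes "optimal V k B ds f T"
  shows "0 < f T"
proof (rule ccontr)
  assume "\<not> 0 < f T"
  have single: "f {\<omega>} \<le> 0" if "\<omega> \<in> V" for \<omega>
  proof -
    have "0 < dmin" using ds_bounds k_pos by (force simp: Min_gr_iff)
    then have "feas {\<omega>}"
      using all_candidates[of "{}" \<omega>] that by (simp add: set_cands)
    then have "f {\<omega>} \<le> f T" using assms by (simp add: optimal_def)
    then show ?thesis using \<open>\<not> 0 < f T\<close> by simp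
  qed
  have "f S = 0" if "S \<subseteq> V" for S
  proof -
    have "f ({} \<union> S) \<le> f {} + (\<Sum>\<omega>\<in>S. f {\<omega>})"
      using that by (intro subadditive_on_union_le_sum[OF subadditive]) (auto intro: finite_subset)
    also have "\<dots> \<le> 0" using that single by (auto intro!: sum_nonpos)
    finally show ?thesis using mono[of "{}" S] that by simp
  qed
  then show False using is_curvature_nonzero[OF curvature] by blast
qed

lemma greedy_approximation:
  assumes "greedy_exec vs k B ds f U t"
  shows "eps_approximation V k B ds f (greedy_ratio \<alpha> dmin d) U"
proof -
  note run = while_exec_greedy[OF assms[unfolded greedy_exec_def] feas_empty]
  have "greedy_ratio \<alpha> dmin d \<le> f U / f T" if T: "optimal V k B ds f T" for T
  proof -
    have "greedy_ratio \<alpha> dmin d * f T \<le> greedy_gain \<alpha> d dmin * f T"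
      using optimal_pos[OF T] greedy_ratio_le_greedy_gain[OF \<alpha>] by (intro mult_right_mono) auto
    \<comment> \<open>The left side is the potential at the empty set, where \<open>f\<close> is 0
      and the overlap with \<open>T\<close> is empty.\<close>
    also have "\<dots> \<le> f U"
      using run(3)[of T] T by (simp add: optimal_def mult.commute)
    finally show ?thesis
      using optimal_pos[OF T] by (simp add: pos_le_divide_eq)
  qed
  then show ?thesis using run(1) by (simp add: eps_approximation_def)
qed

text \<open>The run makes at most \<open>d * (n + 1)\<close> queries with
  \<open>n = length vs\<close>. As \<open>B 1\<close> is nonempty, \<open>n \<ge> 1\<close>, so
  \<open>n + 1 \<le> 2 * n\<close>; this is the source of the constant 2.\<close>

lemma greedy_queries:
  assumes "greedy_exec vs k B ds f U t"
  shows "t \<le> 2 * (d * length vs)"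
proof -
  have "B 1 \<noteq> {}" using ds_bounds[of 1] k_pos by auto
  then have "V \<noteq> {}" using k_pos unfolding cover[symmetric] by auto
  then have "Suc (length vs) \<le> 2 * length vs" by (cases vs) auto
  then have "d * Suc (length vs) \<le> d * (2 * length vs)" by (rule mult_le_mono2)
  then show ?thesis
    using while_exec_greedy(2)[OF assms[unfolded greedy_exec_def] feas_empty]
    by (simp only: card.empty diff_zero mult.left_commute[of _ 2])
qed

end

theorem theorem2:
  "\<exists>C::real. \<forall>(V::'a set) (n::nat) (vs::'a list) (f::'a set \<Rightarrow> real) (\<alpha>::real)
      (k::nat) (B::nat \<Rightarrow> 'a set) (ds::nat \<Rightarrow> nat) (d::nat) (dmin::nat).
     finite V \<longrightarrow> card V = n \<longrightarrow> distinct vs \<longrightarrow> set vs = V \<longrightarrow>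
     (\<forall>S. S \<subseteq> V \<longrightarrow> 0 \<le> f S) \<longrightarrow>
     monotone_set_fun V f \<longrightarrow> subadditive_on V f \<longrightarrow> f {} = 0 \<longrightarrow>
     is_curvature V f \<alpha> \<longrightarrow> \<alpha> \<in> {0..1} \<longrightarrow>
     1 \<le> k \<longrightarrow>
     disjoint_family_on B {1..k} \<longrightarrow> (\<Union>i\<in>{1..k}. B i) = V \<longrightarrow>
     (\<forall>i\<in>{1..k}. 1 \<le> ds i \<and> ds i \<le> card (B i)) \<longrightarrow>
     d = (\<Sum>i=1..k. ds i) \<longrightarrow> dmin = Min (ds ` {1..k}) \<longrightarrow>
     greedy_halts vs k B ds f \<and>
     (\<forall>U t. greedy_exec vs k B ds f U t \<longrightarrow>
        eps_approximation V k B ds f (greedy_ratio \<alpha> dmin d) U \<and>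
        real t \<le> C * (real d * real n))"
proof (intro exI[of _ 2] allI impI)
  fix V :: "'a set" and n :: nat and vs :: "'a list" and f :: "'a set \<Rightarrow> real" and \<alpha> :: real
    and k :: nat and B :: "nat \<Rightarrow> 'a set" and ds :: "nat \<Rightarrow> nat" and d dmin :: nat
  assume hyps: "card V = n" "distinct vs" "set vs = V"
    "monotone_set_fun V f" "subadditive_on V f" "f {} = 0" "is_curvature V f \<alpha>" "\<alpha> \<in> {0..1}"
    "1 \<le> k" "disjoint_family_on B {1..k}" "(\<Union>i\<in>{1..k}. B i) = V"
    "\<forall>i\<in>{1..k}. 1 \<le> ds i \<and> ds i \<le> card (B i)"
    and d: "d = (\<Sum>i=1..k. ds i)" and dmin: "dmin = Min (ds ` {1..k})"
  interpret greedy_problem vs f \<alpha> k B ds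
    using hyps by unfold_locales auto
  have n: "length vs = n" using distinct_card[OF hyps(2)] hyps(1,3) by simp
  have "real t \<le> 2 * (real d * real n)" if "greedy_exec vs k B ds f U t" for U t
  proof -
    have "real t \<le> real (2 * (d * n))"
      using greedy_queries[OF that] unfolding n d by (simp only: of_nat_le_iff)
    then show ?thesis by simp
  qed
  moreover have "greedy_halts vs k B ds f"
    unfolding greedy_halts_def by (rule greedy_halts_from[OF feas_empty])
  ultimately show "greedy_halts vs k B ds f \<and>
     (\<forall>U t. greedy_exec vs k B ds f U t \<longrightarrow>
        eps_approximation V k B ds f (greedy_ratio \<alpha> dmin d) U \<and>
        real t \<le> 2 * (real d * real n))"
    using greedy_approximation unfolding hyps(3) d dmin by blast
qed

end
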